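(* Let $p\ge 1$, let $k$ be a positive integer and let $P_1,\ldots,P_L$ be polygonal curves in $\mathbb{R}^2$, each with $n$ vertices. The time complexity of the Pairwise Algorithm is $O(L^2n^2\log n+G(L,k))$ for discrete simplification, when a $p$-mean curve algorithm of running time $G(L,k)$ is used to compute the output curve with $k$ vertices.
   Context: A polygonal curve $P$ is a finite sequence of points in $\mathbb{R}^2$ together with the segments connecting consecutive points, regarded as a continuous map $[0,1]\to\mathbb{R}^2$. The Fréchet distance is $d_F(P,Q)=\inf_{\alpha,\beta}\max_{t\in[0,1]} \|P(\alpha(t))-Q(\beta(t))\|_2$, over continuous non-decreasing bijections $\alpha,\beta:[0,1]\to[0,1]$. The Fréchet distance of two polygonal curves with $n$ vertices each can be computed in $O(n^2\log n)$ time. A discrete simplification of $P$ is a polygonal curve whose vertex sequence is a subsequence of that of $P$; a min-$\epsilon$ simplification of $P$ is a discrete simplification with at most $k$ vertices minimizing the Fréchet distance to $P$. A $p$-mean curve ($p$-MC) of curves $P_1,\ldots,P_L$ is a polygonal curve $M$ with at most $k$ vertices minimizing $\left(\sum_{i=1}^L d_F(M,P_i)^p\right)^{1/p}$ (in the discrete version, $M$ must be a discrete simplification of one of the input curves). $G(L,k)$ denotes the running time of the $p$-MC algorithm with $k$ output vertices that is used as a subroutine. Pairwise Algorithm: (1) compute $D[i,j]=d_F(P_i,P_j)$ for all $i,j\in\{1,\ldots,L\}$; (2) choose $i^*$ minimizing $\left(\sum_{j=1}^L D[i,j]^p\right)^{1/p}$; (3) output a min-$\epsilon$ simplification of $P_{i^*}$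 with at most $k$ vertices, this step being performed by the subroutine of running time $G(L,k)$. *)

theory Defs
  imports
    "HOL-Analysis.Analysis"
    "HOL-Library.Sublist"
    "HOL-Library.Landau_Symbols"
    "HOL-Library.Monad_Syntax"
begin

section \<open>Polygonal curves and the Frechet distance\<close>

text \<open>A polygonal curve is given by its nonempty list of vertices.\<close>

type_synonym curve = "(real^2) list"

text \<open>The segments are joined by the library's path concatenation, which halves the parameter
  interval at each step.  The choice of parametrisation does not affect the Frechet distance,
  which is invariant under reparametrisation of either curve.\<close>

fun curve_map :: "curve \<Rightarrow> real \<Rightarrow> real^2" where
  "curve_map [] = linepath 0 0"
| "curve_map [a] = linepath a a"
| "curve_map [a, b] = linepath a b"
| "curve_map (a # b # c # xs) = linepath a b +++ curve_map (b # c # xs)"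

definition reparam :: "(real \<Rightarrow> real) \<Rightarrow> bool" where
  "reparam \<alpha> \<longleftrightarrow>
     continuous_on {0..1} \<alpha> \<and> mono_on {0..1} \<alpha> \<and> bij_betw \<alpha> {0..1} {0..1}"

text \<open>The inner supremum is a maximum, by compactness.\<close>

definition frechet_dist :: "curve \<Rightarrow> curve \<Rightarrow> real" where
  "frechet_dist P Q =
     (INF (\<alpha>, \<beta>) \<in> {(\<alpha>, \<beta>). reparam \<alpha> \<and> reparam \<beta>}.
        SUP t \<in> {0..1}. norm (curve_map P (\<alpha> t) - curve_map Q (\<beta> t)))"


section \<open>Simplifications and mean curves\<close>

definition discrete_simplification :: "curve \<Rightarrow> curve \<Rightarrow> bool" where
  "discrete_simplification Q P \<longleftrightarrow> Q \<noteq> [] \<and> subseq Q P"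

definition min_eps_simplification :: "nat \<Rightarrow> curve \<Rightarrow> curve \<Rightarrow> bool" where
  "min_eps_simplification k P Q \<longleftrightarrow>
     discrete_simplification Q P \<and> length Q \<le> k \<and>
     (\<forall>R. discrete_simplification R P \<and> length R \<le> k \<longrightarrow> frechet_dist Q P \<le> frechet_dist R P)"

definition mean_cost :: "real \<Rightarrow> curve list \<Rightarrow> curve \<Rightarrow> real" where
  "mean_cost p Ps M = (\<Sum>P\<leftarrow>Ps. frechet_dist M P powr p) powr (1 / p)"

definition discrete_mean_curve :: "real \<Rightarrow> nat \<Rightarrow> curve list \<Rightarrow> curve \<Rightarrow> bool" where
  "discrete_mean_curve p k Ps M \<longleftrightarrow>
     (\<exists>P\<in>set Ps. discrete_simplification M P) \<and> length M \<le> k \<and>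
     (\<forall>R. (\<exists>P\<in>set Ps. discrete_simplification R P) \<and> length R \<le> k \<longrightarrow>
          mean_cost p Ps M \<le> mean_cost p Ps R)"


section \<open>Timed computations\<close>

text \<open>
  A timed computation carries its result and the number of steps it took.  The cost model is the
  real RAM with linked lists: one arithmetic operation on reals (including powers), one comparison,
  one construction of a list cell or constant, and one (recursive) call each take one step.
  Arithmetic enters a program only through \<open>elem\<close>, applied to a single operation, and every
  function entry is charged by \<open>tick\<close>.
\<close>

datatype 'a timed = Timed (result: 'a) (time: nat)

definition ret :: "'a \<Rightarrow> 'a timed" where
  "ret x = Timed x 0"

definition elem :: "'a \<Rightarrow> 'a timed" where
  "elem x = Timed x 1"

definition tick :: "'a timed \<Rightarrow> 'a timed" where
  "tick m = Timed (result m) (Suc (time m))"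

definition bind_timed :: "'a timed \<Rightarrow> ('a \<Rightarrow> 'b timed) \<Rightarrow> 'b timed" where
  "bind_timed m f = Timed (result (f (result m))) (time m + time (f (result m)))"

adhoc_overloading Monad_Syntax.bind \<rightleftharpoons> bind_timed


section \<open>The Pairwise Algorithm\<close>

fun dist_row ::
  "(curve \<Rightarrow> curve \<Rightarrow> real timed) \<Rightarrow> curve \<Rightarrow> curve list \<Rightarrow> real list timed" where
  "dist_row F P [] = tick (elem [])"
| "dist_row F P (Q # Qs) = tick (do {
     d \<leftarrow> F P Q;
     ds \<leftarrow> dist_row F P Qs;
     elem (d # ds)})"

fun dist_matrix ::
  "(curve \<Rightarrow> curve \<Rightarrow> real timed) \<Rightarrow> curve list \<Rightarrow> curve list \<Rightarrow> real list list timed" where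
  "dist_matrix F [] Qs = tick (elem [])"
| "dist_matrix F (P # Ps) Qs = tick (do {
     ds \<leftarrow> dist_row F P Qs;
     dss \<leftarrow> dist_matrix F Ps Qs;
     elem (ds # dss)})"

fun power_sum :: "real \<Rightarrow> real list \<Rightarrow> real timed" where
  "power_sum p [] = tick (elem 0)"
| "power_sum p (d # ds) = tick (do {
     x \<leftarrow> elem (d powr p);
     s \<leftarrow> power_sum p ds;
     elem (x + s)})"

definition row_cost :: "real \<Rightarrow> real list \<Rightarrow> real timed" where
  "row_cost p ds = tick (do {
     s \<leftarrow> power_sum p ds;
     q \<leftarrow> elem (1 / p);
     elem (s powr q)})"

text \<open>\<open>P\<close> is the best curve found so far and \<open>v\<close> its cost; curves and matrix rows are scanned
  in parallel.\<close>

fun scan_rows :: "real \<Rightarrow> curve \<Rightarrow> real \<Rightarrow> curve list \<Rightarrow> real list list \<Rightarrow> curve timed" where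
  "scan_rows p P v (Q # Qs) (ds # dss) = tick (do {
     w \<leftarrow> row_cost p ds;
     b \<leftarrow> elem (w < v);
     if b then scan_rows p Q w Qs dss else scan_rows p P v Qs dss})"
| "scan_rows p P v _ _ = tick (ret P)"

fun select_curve :: "real \<Rightarrow> curve list \<Rightarrow> real list list \<Rightarrow> curve timed" where
  "select_curve p (P # Ps) (ds # dss) = tick (do {
     v \<leftarrow> row_cost p ds;
     scan_rows p P v Ps dss})"
| "select_curve p _ _ = tick (elem [])"

text \<open>\<open>F\<close> is the subroutine for the Frechet distance, \<open>A\<close> the one for discrete \<open>p\<close>-mean curves.
  A discrete \<open>p\<close>-mean curve of the single curve \<open>P\<close> is the same as a min-\<open>\<epsilon>\<close> simplification of
  \<open>P\<close> (see \<open>discrete_mean_curve_singleton\<close>), so the last step calls \<open>A\<close> on \<open>[P]\<close>.\<close>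

definition pairwise_algorithm ::
  "(curve \<Rightarrow> curve \<Rightarrow> real timed) \<Rightarrow> (curve list \<Rightarrow> nat \<Rightarrow> curve timed) \<Rightarrow>
   real \<Rightarrow> nat \<Rightarrow> curve list \<Rightarrow> curve timed" where
  "pairwise_algorithm F A p k Ps = tick (do {
     D \<leftarrow> dist_matrix F Ps Ps;
     P \<leftarrow> select_curve p Ps D;
     Qs \<leftarrow> elem [P];
     A Qs k})"


section \<open>Specification of the subroutines\<close>

definition computes_frechet :: "(curve \<Rightarrow> curve \<Rightarrow> real timed) \<Rightarrow> bool" where
  "computes_frechet F \<longleftrightarrow>
     (\<forall>P Q. P \<noteq> [] \<and> length Q = length P \<longrightarrow> result (F P Q) = frechet_dist P Q)"

definition frechet_time_bound ::
  "(curve \<Rightarrow> curve \<Rightarrow> real timed) \<Rightarrow> (nat \<Rightarrow> real) \<Rightarrow> bool" where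
  "frechet_time_bound F T \<longleftrightarrow>
     (\<forall>P Q. P \<noteq> [] \<and> length Q = length P \<longrightarrow> real (time (F P Q)) \<le> T (length P))"

definition family :: "nat \<Rightarrow> curve list \<Rightarrow> bool" where
  "family n Ps \<longleftrightarrow> Ps \<noteq> [] \<and> (\<forall>P\<in>set Ps. length P = n)"

definition computes_mean_curve :: "real \<Rightarrow> (curve list \<Rightarrow> nat \<Rightarrow> curve timed) \<Rightarrow> bool" where
  "computes_mean_curve p A \<longleftrightarrow>
     (\<forall>n k Ps. n \<ge> 1 \<and> k \<ge> 1 \<and> family n Ps \<longrightarrow> discrete_mean_curve p k Ps (result (A Ps k)))"

text \<open>\<open>G L k\<close> bounds the worst-case running time on inputs of size up to \<open>L\<close>, that is, of at most
  \<open>L\<close> curves with \<open>n\<close> vertices each.  The dependence of \<open>G\<close> on \<open>n\<close> is implicit: \<open>n\<close> is fixed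
  before \<open>G\<close>.\<close>

definition mean_curve_time_bound ::
  "(curve list \<Rightarrow> nat \<Rightarrow> curve timed) \<Rightarrow> nat \<Rightarrow> (nat \<Rightarrow> nat \<Rightarrow> real) \<Rightarrow> bool" where
  "mean_curve_time_bound A n G \<longleftrightarrow>
     (\<forall>L k Ps. k \<ge> 1 \<and> family n Ps \<and> length Ps \<le> L \<longrightarrow> real (time (A Ps k)) \<le> G L k)"


section \<open>Functional correctness of the program\<close>

lemma path_curve_map: "path (curve_map P) \<and> (P \<noteq> [] \<longrightarrow> pathstart (curve_map P) = hd P)"
proof (induction P rule: curve_map.induct)
  case 1
  show ?case by (simp only: curve_map.simps path_linepath) simp
next
  case (2 a)
  show ?case by (simp only: curve_map.simps path_linepath pathstart_linepath) simp
qed auto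

lemma frechet_dist_nonneg: "0 \<le> frechet_dist P Q"
proof -
  have id: "reparam (\<lambda>x. x)"
    by (auto simp: reparam_def mono_on_def bij_betw_def)
  have "0 \<le> (SUP t\<in>{0..1}. norm (curve_map P (\<alpha> t) - curve_map Q (\<beta> t)))"
    if "reparam \<alpha>" "reparam \<beta>" for \<alpha> \<beta>
  proof -
    have "continuous_on {0..1} (\<lambda>t. curve_map R (\<gamma> t))" if "reparam \<gamma>" for R \<gamma>
      using path_curve_map[of R] that unfolding reparam_def path_def
      by (intro continuous_on_compose2[of "{0..1}" "curve_map R" _ \<gamma>]) (auto simp: bij_betw_def)
    then have "continuous_on {0..1} (\<lambda>t. norm (curve_map P (\<alpha> t) - curve_map Q (\<beta> t)))"
      using that by (intro continuous_intros) auto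
    then have "compact ((\<lambda>t. norm (curve_map P (\<alpha> t) - curve_map Q (\<beta> t))) ` {0..1})"
      by (intro compact_continuous_image) auto
    then have "bdd_above ((\<lambda>t. norm (curve_map P (\<alpha> t) - curve_map Q (\<beta> t))) ` {0..1})"
      by (intro bounded_imp_bdd_above compact_imp_bounded)
    then have "norm (curve_map P (\<alpha> 0) - curve_map Q (\<beta> 0)) \<le>
        (SUP t\<in>{0..1}. norm (curve_map P (\<alpha> t) - curve_map Q (\<beta> t)))"
      by (intro cSUP_upper) auto
    then show ?thesis using norm_ge_zero order_trans by blast
  qed
  then show ?thesis
    unfolding frechet_dist_def using id by (intro cINF_greatest) auto
qed

lemma discrete_mean_curve_singleton:
  assumes "p \<ge> 1"
  shows "discrete_mean_curve p k [P] Q \<longleftrightarrow> min_eps_simplification k P Q"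
proof -
  have "mean_cost p [P] R = frechet_dist R P" for R
    using assms frechet_dist_nonneg[of R P] by (simp add: mean_cost_def powr_powr)
  then show ?thesis
    by (simp add: discrete_mean_curve_def min_eps_simplification_def)
qed

lemma result_monad [simp]:
  "result (ret x) = x" "result (elem x) = x" "result (tick m) = result m"
  "result (bind_timed m f) = result (f (result m))"
  by (simp_all add: ret_def elem_def tick_def bind_timed_def)

lemma result_dist_row:
  "(\<And>Q. Q \<in> set Qs \<Longrightarrow> result (F P Q) = frechet_dist P Q) \<Longrightarrow>
   result (dist_row F P Qs) = map (frechet_dist P) Qs"
  by (induction Qs) auto

lemma result_dist_matrix:
  "(\<And>P Q. P \<in> set Ps \<Longrightarrow> Q \<in> set Qs \<Longrightarrow> result (F P Q) = frechet_dist P Q) \<Longrightarrow>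
   result (dist_matrix F Ps Qs) = map (\<lambda>P. map (frechet_dist P) Qs) Ps"
  by (induction Ps) (auto simp: result_dist_row)

lemma result_row_cost: "result (row_cost p ds) = (\<Sum>d\<leftarrow>ds. d powr p) powr (1 / p)"
proof -
  have "result (power_sum p ds) = (\<Sum>d\<leftarrow>ds. d powr p)"
    by (induction ds) auto
  then show ?thesis by (simp add: row_cost_def)
qed

lemma result_scan_rows:
  fixes f :: "curve \<Rightarrow> real list" and p :: real
  defines "c \<equiv> \<lambda>P. result (row_cost p (f P))"
  shows "result (scan_rows p P (c P) Qs (map f Qs)) \<in> set (P # Qs) \<and>
     (\<forall>R\<in>set (P # Qs). c (result (scan_rows p P (c P) Qs (map f Qs))) \<le> c R)"
proof (induction Qs arbitrary: P)
  case (Cons Q Qs)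
  have "scan_rows p P (c P) (Q # Qs) (map f (Q # Qs)) = tick (do {
     w \<leftarrow> row_cost p (f Q);
     b \<leftarrow> elem (w < c P);
     if b then scan_rows p Q w Qs (map f Qs) else scan_rows p P (c P) Qs (map f Qs)})"
    by simp
  then have "result (scan_rows p P (c P) (Q # Qs) (map f (Q # Qs))) =
     (if c Q < c P then result (scan_rows p Q (c Q) Qs (map f Qs))
      else result (scan_rows p P (c P) Qs (map f Qs)))"
    by (simp add: c_def)
  moreover have "c P \<le> c Q \<or> c Q < c P" by linarith
  ultimately show ?case using Cons.IH[of Q] Cons.IH[of P]
    by (cases "c Q < c P") (force intro: order_trans less_imp_le)+
qed auto

text \<open>The output is a min-\<open>\<epsilon>\<close> simplification of an input curve \<open>P\<close> that minimises
  \<open>mean_cost p Ps\<close> among the input curves.\<close>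

lemma result_pairwise:
  assumes p: "p \<ge> 1" and k: "k \<ge> 1" and n: "n \<ge> 1" and Ps: "family n Ps"
    and F: "computes_frechet F" and A: "computes_mean_curve p A"
  shows "\<exists>P\<in>set Ps. (\<forall>R\<in>set Ps. mean_cost p Ps P \<le> mean_cost p Ps R) \<and>
           min_eps_simplification k P (result (pairwise_algorithm F A p k Ps))"
proof -
  define f where "f = (\<lambda>P. map (frechet_dist P) Ps)"
  define S where "S = result (select_curve p Ps (map f Ps))"
  have D: "result (dist_matrix F Ps Ps) = map f Ps"
    unfolding f_def
  proof (rule result_dist_matrix)
    fix P Q assume "P \<in> set Ps" "Q \<in> set Ps"
    then have "length P = n" "length Q = n" using Ps by (auto simp: family_def)
    then show "result (F P Q) = frechet_dist P Q"
      using F n unfolding computes_frechet_def by (metis list.size(3) not_one_le_zero)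
  qed
  have c: "result (row_cost p (f P)) = mean_cost p Ps P" for P
    by (simp add: result_row_cost f_def mean_cost_def o_def)
  obtain P0 Ps' where P0: "Ps = P0 # Ps'"
    using Ps by (cases Ps) (auto simp: family_def)
  have "S = result (scan_rows p P0 (result (row_cost p (f P0))) Ps' (map f Ps'))"
    by (simp add: S_def P0)
  then have S: "S \<in> set Ps" "\<forall>R\<in>set Ps. mean_cost p Ps S \<le> mean_cost p Ps R"
    using result_scan_rows[where p = p and f = f and P = P0 and Qs = Ps']
    unfolding c P0[symmetric] by auto
  have "discrete_mean_curve p k [S] (result (A [S] k))"
    using A n k S(1) Ps
    by (auto simp: computes_mean_curve_def family_def
             dest: spec[of _ n] spec[of _ k] spec[of _ "[S]"])
  moreover have "result (pairwise_algorithm F A p k Ps) = result (A [S] k)"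
    by (simp add: pairwise_algorithm_def D S_def)
  ultimately show ?thesis
    using S discrete_mean_curve_singleton[OF p] by auto
qed

end

theory Submission
  imports Defs
begin

text \<open>The matrix takes \<open>L^2\<close> calls of \<open>F\<close>, each within
  \<open>T n\<close>. Everything around these calls is list handling: a constant number of steps per
  matrix entry and per row, and again a constant number per entry when the rows are evaluated and
  compared, hence O(\<open>L^2\<close>) in all. The last call receives a single input curve, and
  since \<open>G L k\<close> covers all families of at most \<open>L\<close> curves, it is charged
  \<open>G L k\<close>. \<open>time_pairwise\<close> adds this up with explicit constants. Two
  points give one constant \<open>c\<close> that depends on \<open>T\<close> alone. The bound on
  \<open>T\<close> holds only eventually, but \<open>n^2 ln n\<close> is positive from
  \<open>n = 2\<close> on, so finitely many exceptions only enlarge the factor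
  (\<open>bigo_nat_uniform\<close>). Moreover \<open>n^2 ln n\<close> is at least 1 there
  (\<open>one_le_square_mult_ln\<close>), so it also absorbs the O(\<open>L^2\<close>)
  overhead.\<close>

lemma time_monad [simp]:
  "time (ret x) = 0" "time (elem x) = 1" "time (tick m) = Suc (time m)"
  "time (bind_timed m f) = time m + time (f (result m))"
  by (simp_all add: ret_def elem_def tick_def bind_timed_def)

lemma length_result_dist_row [simp]: "length (result (dist_row F P Qs)) = length Qs"
  by (induction Qs) auto

lemma length_result_dist_matrix [simp]: "length (result (dist_matrix F Ps Qs)) = length Ps"
  by (induction Ps) auto

lemma length_row_dist_matrix:
  "ds \<in> set (result (dist_matrix F Ps Qs)) \<Longrightarrow> length ds = length Qs"
  by (induction Ps) auto

lemma time_dist_row: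
  assumes "\<And>Q. Q \<in> set Qs \<Longrightarrow> real (time (F P Q)) \<le> t"
  shows "real (time (dist_row F P Qs)) \<le> 2 + real (length Qs) * (t + 2)"
  using assms
proof (induction Qs)
  case (Cons Q Qs)
  have "real (time (F P Q)) \<le> t" "real (time (dist_row F P Qs)) \<le> 2 + real (length Qs) * (t + 2)"
    using Cons by auto
  then show ?case by (simp add: algebra_simps)
qed simp

lemma time_dist_matrix:
  assumes "\<And>P Q. P \<in> set Ps \<Longrightarrow> Q \<in> set Qs \<Longrightarrow> real (time (F P Q)) \<le> t"
  shows "real (time (dist_matrix F Ps Qs))
           \<le> 2 + real (length Ps) * (4 + real (length Qs) * (t + 2))"
  using assms
proof (induction Ps)
  case (Cons P Ps)
  have "real (time (dist_row F P Qs)) \<le> 2 + real (length Qs) * (t + 2)"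
    using Cons.prems by (intro time_dist_row) auto
  moreover have "real (time (dist_matrix F Ps Qs))
           \<le> 2 + real (length Ps) * (4 + real (length Qs) * (t + 2))"
    using Cons by auto
  ultimately show ?case by (simp add: algebra_simps)
qed simp

lemma time_row_cost: "time (row_cost p ds) = 3 * length ds + 5"
proof -
  have "time (power_sum p ds) = 3 * length ds + 2"
    by (induction ds) auto
  then show ?thesis by (simp add: row_cost_def)
qed

text \<open>Each round pays \<open>3 * m + 5\<close> for the row cost, one step for the call and one
  for the comparison, whichever branch is taken. The leading 1 is the final call. Only an inequality
  holds because the scan stops at the end of the shorter list.\<close>

lemma time_scan_rows:
  assumes "\<And>ds. ds \<in> set dss \<Longrightarrow> length ds = m"
  shows "time (scan_rows p P v Qs dss) \<le> 1 + length Qs * (3 * m + 7)"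
  using assms
proof (induction p P v Qs dss rule: scan_rows.induct)
  case (1 p P v Q Qs ds dss)
  have "length ds = m" using "1.prems" by simp
  moreover have "time (scan_rows p Q (result (row_cost p ds)) Qs dss) \<le> 1 + length Qs * (3 * m + 7)"
    if "result (row_cost p ds) < v"
    using 1 that by simp
  moreover have "time (scan_rows p P v Qs dss) \<le> 1 + length Qs * (3 * m + 7)"
    if "\<not> result (row_cost p ds) < v"
    using 1 that by simp
  ultimately show ?case by (simp add: time_row_cost)
qed auto

text \<open>The initial value and the rows are arbitrary here. This keeps the selected curve among
  the inputs, so that the time bound for the last call applies to it.\<close>

lemma result_scan_rows_mem: "result (scan_rows p P v Qs dss) \<in> set (P # Qs)"
  by (induction p P v Qs dss rule: scan_rows.induct) auto

lemma time_select_curve: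
  assumes "Ps \<noteq> []" "\<And>ds. ds \<in> set D \<Longrightarrow> length ds = m"
  shows "time (select_curve p Ps D) \<le> length Ps * (3 * m + 7)"
proof -
  obtain P Qs where Ps: "Ps = P # Qs" using assms(1) by (cases Ps) auto
  show ?thesis
  proof (cases D)
    case (Cons ds dss)
    define v where "v = result (row_cost p ds)"
    have "time (scan_rows p P v Qs dss) \<le> 1 + length Qs * (3 * m + 7)"
      using assms(2) Cons by (intro time_scan_rows) auto
    then show ?thesis
      \<comment> \<open>The entry call and the final call of the scan are the two steps that
        complete the cost of the first row to \<open>3 * m + 7\<close>.\<close>
      using assms(2)[of ds] Ps Cons by (simp add: time_row_cost v_def)
  qed (simp add: Ps)
qed

text \<open>Both lists must be nonempty: otherwise \<open>select_curve\<close> returns its default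
  \<open>[]\<close>, which need not be an input curve.\<close>

lemma result_select_curve_mem:
  assumes "Ps \<noteq> []" "D \<noteq> []"
  shows "result (select_curve p Ps D) \<in> set Ps"
  using assms result_scan_rows_mem by (cases Ps; cases D) auto

lemma time_pairwise:
  assumes F: "\<And>P Q. P \<in> set Ps \<Longrightarrow> Q \<in> set Ps \<Longrightarrow> real (time (F P Q)) \<le> t"
    and A: "\<And>P. P \<in> set Ps \<Longrightarrow> real (time (A [P] k)) \<le> g"
    and "Ps \<noteq> []"
  shows "real (time (pairwise_algorithm F A p k Ps)) \<le> real (length Ps) ^ 2 * (t + 20) + g"
proof -
  define L where "L = real (length Ps)"
  define D where "D = result (dist_matrix F Ps Ps)"
  define S where "S = result (select_curve p Ps D)"
  have "D \<noteq> []"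
    using assms(3) unfolding D_def length_0_conv[symmetric] by simp
  then have S: "real (time (A [S] k)) \<le> g"
    unfolding S_def using assms(3) by (intro A result_select_curve_mem)
  have "time (select_curve p Ps D) \<le> length Ps * (3 * length Ps + 7)"
    using assms(3) length_row_dist_matrix by (intro time_select_curve) (auto simp: D_def)
  then have "real (time (select_curve p Ps D)) \<le> real (length Ps * (3 * length Ps + 7))"
    by (rule of_nat_mono)
  then have sel: "real (time (select_curve p Ps D)) \<le> L * (3 * L + 7)"
    by (simp add: L_def)
  have mat: "real (time (dist_matrix F Ps Ps)) \<le> 2 + L * (4 + L * (t + 2))"
    unfolding L_def using F by (rule time_dist_matrix)
  have "1 \<le> L" using assms(3) by (cases Ps) (auto simp: L_def)
  then have L: "L \<le> L\<^sup>2" "1 \<le> L\<^sup>2"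
    by (simp_all add: power2_eq_square mult_le_cancel_left1 mult_ge1_I)
  have "real (time (pairwise_algorithm F A p k Ps)) =
      2 + real (time (dist_matrix F Ps Ps)) + real (time (select_curve p Ps D))
        + real (time (A [S] k))"
    by (simp add: pairwise_algorithm_def D_def S_def)
  also have "\<dots> \<le> 2 + (2 + L * (4 + L * (t + 2))) + L * (3 * L + 7) + g"
    using mat sel S by linarith
  also have "\<dots> = L\<^sup>2 * (t + 5) + 11 * L + 4 + g"
    by (simp add: algebra_simps power2_eq_square)
  \<comment> \<open>Since \<open>L\<close> is at least 1, both \<open>L\<close> and 1 are at most
    \<open>L^2\<close>, and 20 = 5 + 11 + 4.\<close>
  also have "\<dots> \<le> L\<^sup>2 * (t + 20) + g"
    using L by (simp add: algebra_simps)
  finally show ?thesis by (simp add: L_def)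
qed

lemma bigo_nat_uniform:
  fixes T g :: "nat \<Rightarrow> real"
  assumes "T \<in> O(g)" and pos: "\<And>n. n \<ge> m \<Longrightarrow> g n > 0"
  shows "\<exists>c>0. \<forall>n\<ge>m. T n \<le> c * g n"
proof -
  obtain C where "C > 0" "eventually (\<lambda>n. norm (T n) \<le> C * norm (g n)) sequentially"
    using assms(1) by (auto elim: landau_o.bigE)
  then obtain N where N: "\<And>n. n \<ge> N \<Longrightarrow> \<bar>T n\<bar> \<le> C * \<bar>g n\<bar>"
    by (auto simp: eventually_sequentially)
  \<comment> \<open>The sum dominates the ratio at each of the finitely many exceptional indices.
    Indices below \<open>m\<close> may occur in it, where \<open>g\<close> can vanish; the absolute
    values keep every term nonnegative.\<close>
  define B where "B = (\<Sum>n<N. \<bar>T n / g n\<bar>)"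
  have "B \<ge> 0" by (simp add: B_def sum_nonneg)
  have "T n \<le> (C + B) * g n" if "n \<ge> m" for n
  proof (cases "n \<ge> N")
    case True
    have "T n \<le> C * g n" using N[OF True] pos[OF that] by simp
    also have "\<dots> \<le> (C + B) * g n"
      using \<open>B \<ge> 0\<close> pos[OF that] by (intro mult_right_mono) auto
    finally show ?thesis .
  next
    case False
    then have "\<bar>T n / g n\<bar> \<le> B"
      unfolding B_def by (intro member_le_sum) auto
    then have "T n / g n \<le> C + B" using \<open>C > 0\<close> by linarith
    then show ?thesis using pos[OF that] by (simp add: pos_divide_le_eq)
  qed
  then show ?thesis using \<open>C > 0\<close> \<open>B \<ge> 0\<close> by (intro exI[of _ "C + B"]) auto
qed

lemma one_le_square_mult_ln:
  fixes x :: real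
  assumes "2 \<le> x"
  shows "1 \<le> x\<^sup>2 * ln x"
proof -
  \<comment> \<open>This is \<open>ln y \<le> y - 1\<close> at \<open>y = 1 / x\<close>; it gives
    \<open>ln x\<close> at least 1/2, while \<open>x^2\<close> is at least 4.\<close>
  have "1 - 1 / x \<le> ln x"
    using ln_le_minus_one[of "1 / x"] assms by (simp add: ln_div)
  moreover have "1 / x \<le> 1 / 2" using assms by (simp add: divide_simps)
  ultimately have "1 / 2 \<le> ln x" by linarith
  moreover have "4 \<le> x\<^sup>2" using power_mono[OF assms, of 2] by simp
  ultimately have "4 * (1 / 2) \<le> x\<^sup>2 * ln x" by (intro mult_mono) auto
  then show ?thesis by simp
qed

theorem lemma9:
  fixes F :: "curve \<Rightarrow> curve \<Rightarrow> real timed"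
    and T :: "nat \<Rightarrow> real"
  assumes "computes_frechet F"
    and "frechet_time_bound F T"
    and "T \<in> O(\<lambda>n. real n ^ 2 * ln (real n))"
  shows "\<exists>c>0. \<forall>(p::real) (A :: curve list \<Rightarrow> nat \<Rightarrow> curve timed) (n::nat) (G :: nat \<Rightarrow> nat \<Rightarrow> real).
           p \<ge> 1 \<and> n \<ge> 2 \<and> computes_mean_curve p A \<and> mean_curve_time_bound A n G \<longrightarrow>
           (\<forall>(L::nat) (k::nat) (Ps :: curve list).
              L \<ge> 1 \<and> k \<ge> 1 \<and> length Ps = L \<and> (\<forall>P\<in>set Ps. length P = n) \<longrightarrow>
              real (time (pairwise_algorithm F A p k Ps))
                \<le> c * (real L ^ 2 * real n ^ 2 * ln (real n) + G L k))"
proof -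
  have ge1: "1 \<le> real n ^ 2 * ln (real n)" if "n \<ge> 2" for n :: nat
    using that by (intro one_le_square_mult_ln) simp
  then have "\<exists>C>0. \<forall>n\<ge>2. T n \<le> C * (real n ^ 2 * ln (real n))"
    by (intro bigo_nat_uniform[OF assms(3)]) (use less_le_trans zero_less_one in blast)
  then obtain C where C: "C > 0" "\<And>n. n \<ge> 2 \<Longrightarrow> T n \<le> C * (real n ^ 2 * ln (real n))"
    by blast
  have "real (time (pairwise_algorithm F A p k Ps))
      \<le> (C + 20) * (real L ^ 2 * real n ^ 2 * ln (real n) + G L k)"
    if n: "n \<ge> 2" and G: "mean_curve_time_bound A n G" and "L \<ge> 1" "k \<ge> 1"
      and L: "length Ps = L" and Ps: "\<forall>P\<in>set Ps. length P = n"
    for p A n G L k Ps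
  proof -
    define h where "h = real n ^ 2 * ln (real n)"
    have F: "real (time (F P Q)) \<le> T n" if "P \<in> set Ps" "Q \<in> set Ps" for P Q
    proof -
      have "length P = n" "length Q = n" using Ps that by auto
      moreover from this have "P \<noteq> []" using n by auto
      ultimately show ?thesis using assms(2) unfolding frechet_time_bound_def by metis
    qed
    have A: "real (time (A [P] k)) \<le> G L k" if "P \<in> set Ps" for P
    proof -
      have "family n [P]" "length [P] \<le> L" using Ps that \<open>L \<ge> 1\<close> by (auto simp: family_def)
      then show ?thesis using G \<open>k \<ge> 1\<close> unfolding mean_curve_time_bound_def by blast
    qed
    have "Ps \<noteq> []" using L \<open>L \<ge> 1\<close> by auto
    \<comment> \<open>\<open>G\<close> is an arbitrary real function, but here it bounds an actual
      running time. Nonnegativity is what allows multiplying it by \<open>C + 20\<close> in the next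
      step.\<close>
    then have "G L k \<ge> 0" using A[of "hd Ps"] by (auto intro: order_trans[rotated])
    then have "G L k \<le> (C + 20) * G L k" using C(1) by (simp add: mult_le_cancel_right1)
    \<comment> \<open>The overhead 20 is at most \<open>20 * h\<close> because \<open>h\<close> is
      at least 1.\<close>
    moreover have "T n + 20 \<le> (C + 20) * h"
      using C(2)[OF n] ge1[OF n] unfolding h_def[symmetric] by (simp add: algebra_simps)
    then have "real L ^ 2 * (T n + 20) \<le> real L ^ 2 * ((C + 20) * h)"
      by (intro mult_left_mono) auto
    moreover have "real (time (pairwise_algorithm F A p k Ps)) \<le> real L ^ 2 * (T n + 20) + G L k"
      unfolding L[symmetric] using F A \<open>Ps \<noteq> []\<close> by (intro time_pairwise) (simp_all add: L)
    ultimately have "real (time (pairwise_algorithm F A p k Ps))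
        \<le> real L ^ 2 * ((C + 20) * h) + (C + 20) * G L k"
      by linarith
    then show ?thesis by (simp add: h_def algebra_simps)
  qed
  then show ?thesis using C(1) by (intro exI[of _ "C + 20"]) auto
qed

end
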